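(* Let $n,k$ be integers with $n\ge 4$ and $2\le k\le (n+1)/2$, and suppose that $k$ and $n-k+1$ are coprime. Let $X_{n,k}$ be the tree obtained from two disjoint paths with $n$ vertices each, with vertices $v_1,\dots,v_n$ and $v'_1,\dots,v'_n$ respectively (in this order along the paths), by identifying $v_k$ with $v'_k$. Then the tree $X_{n,k}$ does not have any dominant vertex.
   Context: The path with vertices $v_1,\dots,v_n$ in this order has edges $\{v_i,v_{i+1}\}$ for $1\le i\le n-1$. Thus $X_{n,k}$ has $2n-1$ vertices and $2n-2$ edges. For a finite graph $G=(V,E)$, the adjacency operator $A$ is the self-adjoint operator on $\ell^2(V)=\mathbf{C}^V$ given by $(A\xi)(v)=\sum_{w:\{v,w\}\in E}\xi(w)$; $\delta_v$ is the characteristic function of $\{v\}$. The local spectral measure $\mu_\xi$ of $A$ at $\xi$ is the positive measure on the spectrum $\Sigma(A)$ with $\int f\,d\mu_\xi=\langle f(A)\xi\mid\xi\rangle$ for all functions $f:\Sigma(A)\to\mathbf{C}$. A vertex $v$ is dominant if for every $\eta\in\ell^2(V)$ the measure $\mu_\eta$ is absolutely continuous with respect to $\mu_{\delta_v}$. *)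

theory Defs
  imports "HOL-Analysis.Analysis"
begin

type_synonym 'v graph = "'v set \<times> 'v set set"

definition verts :: "'v graph \<Rightarrow> 'v set" where
  "verts G = fst G"

definition edges :: "'v graph \<Rightarrow> 'v set set" where
  "edges G = snd G"

definition path_graph :: "nat \<Rightarrow> nat graph" where
  "path_graph n = ({1..n}, {{i, i + 1} |i. 1 \<le> i \<and> i < n})"

definition map_graph :: "('v \<Rightarrow> 'w) \<Rightarrow> 'v graph \<Rightarrow> 'w graph" where
  "map_graph h G = (h ` verts G, (\<lambda>e. h ` e) ` edges G)"

definition disjoint_union :: "'v graph \<Rightarrow> 'w graph \<Rightarrow> ('v + 'w) graph" where
  "disjoint_union G H =
     (verts (map_graph Inl G) \<union> verts (map_graph Inr H),
      edges (map_graph Inl G) \<union> edges (map_graph Inr H))"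

(* The quotient that glues b to a; the class {a, b} is represented by a. *)
definition identify :: "'v \<Rightarrow> 'v \<Rightarrow> 'v graph \<Rightarrow> 'v graph" where
  "identify a b G = map_graph (\<lambda>x. if x = b then a else x) G"

(* Inl i is the vertex v_i and Inr i is v'_i; after the gluing, v_k = v'_k is Inl k. *)
definition X_tree :: "nat \<Rightarrow> nat \<Rightarrow> (nat + nat) graph" where
  "X_tree n k = identify (Inl k) (Inr k) (disjoint_union (path_graph n) (path_graph n))"

(* Functions on the vertex set, encoded as functions on the type that vanish off it. *)
definition ell2 :: "'v graph \<Rightarrow> ('v \<Rightarrow> complex) set" where
  "ell2 G = {\<xi>. \<forall>x. x \<notin> verts G \<longrightarrow> \<xi> x = 0}"

definition ip :: "'v graph \<Rightarrow> ('v \<Rightarrow> complex) \<Rightarrow> ('v \<Rightarrow> complex) \<Rightarrow> complex" where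
  "ip G \<xi> \<eta> = (\<Sum>v\<in>verts G. \<xi> v * cnj (\<eta> v))"

definition delta :: "'v \<Rightarrow> 'v \<Rightarrow> complex" where
  "delta v = indicator {v}"

definition adj_op :: "'v graph \<Rightarrow> ('v \<Rightarrow> complex) \<Rightarrow> 'v \<Rightarrow> complex" where
  "adj_op G \<xi> v =
     (if v \<in> verts G then \<Sum>w\<in>{w \<in> verts G. {v, w} \<in> edges G}. \<xi> w else 0)"

definition eigenspace :: "'v graph \<Rightarrow> complex \<Rightarrow> ('v \<Rightarrow> complex) set" where
  "eigenspace G \<theta> = {\<xi> \<in> ell2 G. adj_op G \<xi> = (\<lambda>v. \<theta> * \<xi> v)}"

definition spectrum :: "'v graph \<Rightarrow> complex set" where
  "spectrum G = {\<theta>. \<exists>\<xi>\<in>eigenspace G \<theta>. \<xi> \<noteq> (\<lambda>v. 0)}"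

definition orth_proj :: "'v graph \<Rightarrow> ('v \<Rightarrow> complex) set \<Rightarrow> ('v \<Rightarrow> complex) \<Rightarrow> 'v \<Rightarrow> complex" where
  "orth_proj G S \<xi> = (THE \<eta>. \<eta> \<in> S \<and> (\<forall>\<zeta>\<in>S. ip G (\<lambda>v. \<xi> v - \<eta> v) \<zeta> = 0))"

(* The operator f(A), through the spectral decomposition of the self-adjoint operator A. *)
definition fun_calc :: "'v graph \<Rightarrow> (complex \<Rightarrow> complex) \<Rightarrow> ('v \<Rightarrow> complex) \<Rightarrow> 'v \<Rightarrow> complex" where
  "fun_calc G f \<xi> = (\<lambda>v. \<Sum>\<theta>\<in>spectrum G. f \<theta> * orth_proj G (eigenspace G \<theta>) \<xi> v)"

(* Finiteness of the measure is required explicitly because the Bochner integral of a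
   non-integrable function is 0 by convention. As every subset of the spectrum is
   measurable, every f is measurable. *)
definition is_local_spectral_measure ::
    "'v graph \<Rightarrow> ('v \<Rightarrow> complex) \<Rightarrow> complex measure \<Rightarrow> bool" where
  "is_local_spectral_measure G \<xi> \<mu> \<longleftrightarrow>
     sets \<mu> = Pow (spectrum G) \<and> finite_measure \<mu> \<and>
     (\<forall>f :: complex \<Rightarrow> complex. (LINT x|\<mu>. f x) = ip G (fun_calc G f \<xi>) \<xi>)"

definition local_spectral_measure :: "'v graph \<Rightarrow> ('v \<Rightarrow> complex) \<Rightarrow> complex measure" where
  "local_spectral_measure G \<xi> = (THE \<mu>. is_local_spectral_measure G \<xi> \<mu>)"

(* The library's absolutely_continuous M N says that N is absolutely continuous
   with respect to M. *)
definition dominant :: "'v graph \<Rightarrow> 'v \<Rightarrow> bool" where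
  "dominant G v \<longleftrightarrow> v \<in> verts G \<and>
     (\<forall>\<eta>\<in>ell2 G. absolutely_continuous (local_spectral_measure G (delta v))
                                      (local_spectral_measure G \<eta>))"

end

theory Submission
  imports Defs
begin

text \<open>
  If a vertex \<open>v\<close> is dominant then every eigenvalue has an eigenvector that does not vanish at \<open>v\<close>:
  otherwise \<open>{\<theta>}\<close> is a null set for the measure at \<open>\<delta>\<^sub>v\<close>, but not for the measure at an eigenvector.

  Put \<open>q = n - k + 1\<close>, so that the center of the tree carries two arms of length \<open>k - 1\<close> and two of
  length \<open>q - 1\<close>. Read from the leaf of an arm, an eigenvector for \<open>2 cos \<alpha>\<close> is a multiple of
  \<open>sin (i \<alpha>)\<close>. For \<open>\<alpha> = pi / k\<close> this gives \<open>0\<close> at the center, reached at \<open>i = k\<close> along a left arm;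
  along a right arm the center is reached at \<open>i = q\<close>, and \<open>sin (q \<alpha>) \<noteq> 0\<close> because \<open>k\<close> does not divide
  \<open>q\<close>, so the eigenvector vanishes on the right arms. For \<open>\<beta> = pi / q\<close> it vanishes at the center and
  on the left arms in the same way. Both numbers are eigenvalues, with eigenvectors that are
  antisymmetric under the exchange of the two paths. Hence no vertex is dominant.
\<close>

subsection \<open>Orthogonal projections and eigenspaces\<close>

lemma ip_diff_left: "ip G (\<lambda>v. \<xi> v - \<eta> v) \<zeta> = ip G \<xi> \<zeta> - ip G \<eta> \<zeta>"
  by (simp add: ip_def left_diff_distrib sum_subtractf)

lemma ip_scale_left: "ip G (\<lambda>v. c * \<xi> v) \<zeta> = c * ip G \<xi> \<zeta>"
  by (simp add: ip_def sum_distrib_left mult.assoc)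

lemma ip_sum_left: "ip G (\<lambda>v. \<Sum>i\<in>I. f i v) \<zeta> = (\<Sum>i\<in>I. ip G (f i) \<zeta>)"
  unfolding ip_def sum_distrib_right by (rule sum.swap)

lemma ip_commute: "ip G \<eta> \<xi> = cnj (ip G \<xi> \<eta>)"
  by (simp add: ip_def mult.commute)

lemma ip_eq_0_commute: "ip G \<eta> \<xi> = 0 \<longleftrightarrow> ip G \<xi> \<eta> = 0"
  by (subst ip_commute) simp

lemma ip_scale_right: "ip G \<zeta> (\<lambda>v. c * \<xi> v) = cnj c * ip G \<zeta> \<xi>"
  by (simp add: ip_def sum_distrib_left mult.left_commute)

lemma ip_zero_left: "ip G (\<lambda>v. 0) \<zeta> = 0"
  by (simp add: ip_def)

lemma ip_self: "ip G \<xi> \<xi> = of_real (\<Sum>v\<in>verts G. (cmod (\<xi> v))\<^sup>2)"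
  unfolding ip_def of_real_sum by (intro sum.cong refl) (rule complex_norm_square [symmetric])

section \<open>Linear subspaces, orthonormal sets and Fourier sums\<close>

definition linear_subspace :: "'v graph \<Rightarrow> ('v \<Rightarrow> complex) set \<Rightarrow> bool" where
  "linear_subspace G S \<longleftrightarrow> S \<subseteq> ell2 G \<and> (\<lambda>v. 0) \<in> S \<and>
     (\<forall>\<xi>\<in>S. \<forall>\<eta>\<in>S. (\<lambda>v. \<xi> v + \<eta> v) \<in> S) \<and> (\<forall>c. \<forall>\<xi>\<in>S. (\<lambda>v. c * \<xi> v) \<in> S)"

lemma linear_subspace_add:
  "linear_subspace G S \<Longrightarrow> \<xi> \<in> S \<Longrightarrow> \<eta> \<in> S \<Longrightarrow> (\<lambda>v. \<xi> v + \<eta> v) \<in> S"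
  by (simp add: linear_subspace_def)

lemma linear_subspace_scale: "linear_subspace G S \<Longrightarrow> \<xi> \<in> S \<Longrightarrow> (\<lambda>v. c * \<xi> v) \<in> S"
  by (simp add: linear_subspace_def)

lemma linear_subspace_diff:
  assumes "linear_subspace G S" "\<xi> \<in> S" "\<eta> \<in> S"
  shows "(\<lambda>v. \<xi> v - \<eta> v) \<in> S"
  using linear_subspace_add[OF assms(1,2) linear_subspace_scale[OF assms(1,3), of "-1"]] by simp

lemma linear_subspace_sum:
  assumes "linear_subspace G S" "\<And>i. i \<in> I \<Longrightarrow> f i \<in> S"
  shows "(\<lambda>v. \<Sum>i\<in>I. f i v) \<in> S"
  using assms(2)
\<comment> \<open>Infinite index sets are included: the sum is then 0 by convention, which lies in
  \<open>S\<close>.\<close>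
proof (induction I rule: infinite_finite_induct)
  case (insert i I)
  then have "(\<lambda>v. f i v + (\<Sum>i\<in>I. f i v)) \<in> S"
    by (intro linear_subspace_add[OF assms(1)]) auto
  with insert show ?case by simp
qed (use assms(1) in \<open>simp_all add: linear_subspace_def\<close>)

definition orthonormal :: "'v graph \<Rightarrow> ('v \<Rightarrow> complex) set \<Rightarrow> bool" where
  "orthonormal G E \<longleftrightarrow> (\<forall>e\<in>E. \<forall>f\<in>E. ip G e f = (if e = f then 1 else 0))"

text \<open>For orthonormal \<open>E\<close> this is the orthogonal projection of
  \<open>\<xi>\<close> onto the span of \<open>E\<close>.\<close>

definition fourier_sum :: "'v graph \<Rightarrow> ('v \<Rightarrow> complex) set \<Rightarrow> ('v \<Rightarrow> complex) \<Rightarrow> 'v \<Rightarrow> complex" where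
  "fourier_sum G E \<xi> = (\<lambda>v. \<Sum>e\<in>E. ip G \<xi> e * e v)"

lemma ip_fourier_sum:
  assumes "finite E" "orthonormal G E" "e \<in> E"
  shows "ip G (\<lambda>v. \<xi> v - fourier_sum G E \<xi> v) e = 0"
proof -
  have "ip G (fourier_sum G E \<xi>) e = (\<Sum>f\<in>E. ip G \<xi> f * ip G f e)"
    by (simp add: fourier_sum_def ip_sum_left ip_scale_left)
  also have "\<dots> = (\<Sum>f\<in>E. if f = e then ip G \<xi> f else 0)"
    using assms by (intro sum.cong) (auto simp: orthonormal_def)
  also have "\<dots> = ip G \<xi> e"
    using assms by simp
  finally show ?thesis by (simp add: ip_diff_left)
qed

lemma ip_fourier_sum_left:
  "ip G (fourier_sum G E \<xi>) \<zeta> = (\<Sum>e\<in>E. ip G \<xi> e * ip G e \<zeta>)"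
  by (simp add: fourier_sum_def ip_sum_left ip_scale_left)

lemma scaled_unit:
  assumes "ip G \<xi> \<xi> \<noteq> 0"
  obtains c where "c \<noteq> 0" "ip G (\<lambda>v. c * \<xi> v) (\<lambda>v. c * \<xi> v) = 1"
proof -
  define r where "r = (\<Sum>v\<in>verts G. (cmod (\<xi> v))\<^sup>2)"
  have "r \<ge> 0" unfolding r_def by (intro sum_nonneg) simp
  moreover have "ip G \<xi> \<xi> = of_real r" by (simp add: r_def ip_self)
  ultimately have r: "r > 0" "ip G \<xi> \<xi> = of_real r" using assms by (auto simp: less_le)
  define c :: complex where "c = of_real (1 / sqrt r)"
  have "c * cnj c = of_real ((1 / sqrt r) * (1 / sqrt r))"
    unfolding c_def complex_cnj_complex_of_real of_real_mult ..
  also have "(1 / sqrt r) * (1 / sqrt r) = 1 / r" using r by simp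
  finally have "ip G (\<lambda>v. c * \<xi> v) (\<lambda>v. c * \<xi> v) = 1"
    using r by (simp add: ip_scale_left ip_scale_right flip: mult.assoc)
  moreover have "c \<noteq> 0" using r by (simp add: c_def)
  ultimately show thesis using that by blast
qed

context
  fixes G :: "'v graph"
  assumes fin: "finite (verts G)"
begin

text \<open>\<open>ip\<close> sees only the values at vertices; membership in \<open>ell2 G\<close>
  settles the others.\<close>

lemma ip_self_eq_0_iff:
  assumes "\<xi> \<in> ell2 G"
  shows "ip G \<xi> \<xi> = 0 \<longleftrightarrow> \<xi> = (\<lambda>v. 0)"
proof
  assume "ip G \<xi> \<xi> = 0"
  then have "(\<Sum>v\<in>verts G. (cmod (\<xi> v))\<^sup>2) = 0"
    by (simp add: ip_self del: of_real_sum)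
  then have "\<forall>v\<in>verts G. \<xi> v = 0"
    using fin by (simp add: sum_nonneg_eq_0_iff)
  with assms show "\<xi> = (\<lambda>v. 0)" by (auto simp: ell2_def)
qed (simp add: ip_zero_left)

lemma ip_delta_left: "v \<in> verts G \<Longrightarrow> ip G (delta v) \<xi> = cnj (\<xi> v)"
proof -
  assume v: "v \<in> verts G"
  have "ip G (delta v) \<xi> = (\<Sum>w\<in>verts G. if w = v then cnj (\<xi> w) else 0)"
    unfolding ip_def delta_def by (intro sum.cong) (auto simp: indicator_def)
  then show ?thesis using v fin by simp
qed

text \<open>Bessel's inequality for the unit vector \<open>delta v\<close>, whose Fourier
  coefficient at \<open>e\<close> is \<open>cnj (e v)\<close>. The residual \<open>r\<close> is
  orthogonal to the Fourier sum, so its squared norm is \<open>ip G (delta v) r\<close>, which is 1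
  minus the sum in question.\<close>

lemma bessel_delta:
  assumes "finite E" "orthonormal G E" "v \<in> verts G"
  shows "(\<Sum>e\<in>E. (cmod (e v))\<^sup>2) \<le> 1"
proof -
  define r where "r = (\<lambda>w. delta v w - fourier_sum G E (delta v) w)"
  have orth: "ip G r e = 0" if "e \<in> E" for e
    unfolding r_def using ip_fourier_sum[OF assms(1,2) that] .
  have "ip G e r = 0" if "e \<in> E" for e
    using orth[OF that] by (subst ip_eq_0_commute)
  then have "ip G (fourier_sum G E (delta v)) r = 0"
    by (simp add: ip_fourier_sum_left)
  then have "ip G r r = ip G (delta v) r"
    by (simp add: r_def ip_diff_left)
  also have "\<dots> = cnj (r v)"
    using assms by (simp add: ip_delta_left)
  also have "r v = 1 - (\<Sum>e\<in>E. cnj (e v) * e v)"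
    using assms by (simp add: r_def fourier_sum_def ip_delta_left) (simp add: delta_def)
  also have "(\<Sum>e\<in>E. cnj (e v) * e v) = of_real (\<Sum>e\<in>E. (cmod (e v))\<^sup>2)"
    by (simp add: mult.commute flip: complex_norm_square)
  finally have "of_real (\<Sum>w\<in>verts G. (cmod (r w))\<^sup>2) =
      (of_real (1 - (\<Sum>e\<in>E. (cmod (e v))\<^sup>2)) :: complex)"
    by (simp add: ip_self)
  then have "(\<Sum>w\<in>verts G. (cmod (r w))\<^sup>2) = 1 - (\<Sum>e\<in>E. (cmod (e v))\<^sup>2)"
    by (simp only: of_real_eq_iff)
  moreover have "(\<Sum>w\<in>verts G. (cmod (r w))\<^sup>2) \<ge> 0"
    by (intro sum_nonneg) simp
  ultimately show ?thesis by simp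
qed

text \<open>Summing Bessel's inequality over all vertices bounds the size of orthonormal sets. This replaces
  dimension theory: it yields both orthogonal projections and the finiteness of the spectrum.\<close>

lemma card_orthonormal_le:
  assumes "finite E" "orthonormal G E"
  shows "card E \<le> card (verts G)"
proof -
  have "of_nat (card E) = (\<Sum>e\<in>E. (\<Sum>v\<in>verts G. (cmod (e v))\<^sup>2))"
  proof -
    have "(\<Sum>v\<in>verts G. (cmod (e v))\<^sup>2) = 1" if "e \<in> E" for e
    proof -
      have "of_real (\<Sum>v\<in>verts G. (cmod (e v))\<^sup>2) = (of_real 1 :: complex)"
        unfolding ip_self[symmetric] using assms that by (simp add: orthonormal_def)
      then show ?thesis by (simp only: of_real_eq_iff)
    qed
    then show ?thesis by simp
  qed
  also have "\<dots> = (\<Sum>v\<in>verts G. \<Sum>e\<in>E. (cmod (e v))\<^sup>2)"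
    by (rule sum.swap)
  also have "\<dots> \<le> (\<Sum>v\<in>verts G. 1)"
    by (intro sum_mono bessel_delta assms)
  finally show ?thesis by simp
qed

text \<open>The cardinality bound provides an orthonormal subset of \<open>S\<close> of greatest
  size. It spans \<open>S\<close>, since a nonzero residual could be normalized and added to
  it.\<close>

lemma ex_orthonormal_basis:
  assumes S: "linear_subspace G S"
  obtains E where "finite E" "E \<subseteq> S" "orthonormal G E" "\<And>\<zeta>. \<zeta> \<in> S \<Longrightarrow> \<zeta> = fourier_sum G E \<zeta>"
proof -
  define P where "P E \<longleftrightarrow> finite E \<and> E \<subseteq> S \<and> orthonormal G E" for E
  have "P {}" by (simp add: P_def orthonormal_def)
  moreover have "\<forall>E. P E \<longrightarrow> card E \<le> card (verts G)"
    using card_orthonormal_le by (auto simp: P_def)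
  ultimately obtain E where E: "P E" and max: "\<And>F. P F \<Longrightarrow> card F \<le> card E"
    using ex_has_greatest_nat[of P "{}" card "Suc (card (verts G))"] by (auto simp: less_Suc_eq_le)
  have "\<zeta> = fourier_sum G E \<zeta>" if \<zeta>: "\<zeta> \<in> S" for \<zeta>
  proof -
    define r where "r = (\<lambda>v. \<zeta> v - fourier_sum G E \<zeta> v)"
    have "fourier_sum G E \<zeta> \<in> S"
      unfolding fourier_sum_def using E S
      by (intro linear_subspace_sum[OF S]) (auto simp: P_def linear_subspace_def)
    then have rS: "r \<in> S" unfolding r_def by (rule linear_subspace_diff[OF S \<zeta>])
    have orth: "ip G r e = 0" if "e \<in> E" for e
      using E that ip_fourier_sum unfolding r_def P_def by blast
    have "ip G r r = 0"
    proof (rule ccontr)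
      assume "ip G r r \<noteq> 0"
      then obtain c where c: "c \<noteq> 0" "ip G (\<lambda>v. c * r v) (\<lambda>v. c * r v) = 1"
        by (rule scaled_unit)
      define u where "u = (\<lambda>v. c * r v)"
      have u: "ip G u u = 1" "\<And>e. e \<in> E \<Longrightarrow> ip G u e = 0"
        using c orth by (simp_all add: u_def ip_scale_left)
      then have "\<And>e. e \<in> E \<Longrightarrow> ip G e u = 0"
        by (subst ip_eq_0_commute)
      moreover have "u \<in> S" using S rS by (auto simp: u_def linear_subspace_def)
      ultimately have "P (insert u E)"
        using E u by (auto simp: P_def orthonormal_def)
      moreover have "u \<notin> E" using u by force
      ultimately show False using max[of "insert u E"] E by (simp add: P_def)
    qed
    then have "r = (\<lambda>v. 0)"
      using rS S ip_self_eq_0_iff by (auto simp: linear_subspace_def)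
    then show ?thesis by (auto simp: r_def fun_eq_iff)
  qed
  with E that show thesis by (auto simp: P_def)
qed

text \<open>\<open>orth_proj\<close> is a definite description, so existence and uniqueness come
  first. The Fourier sum over an orthonormal basis exists as a candidate; the difference of two
  candidates lies in \<open>S\<close> and is orthogonal to itself.\<close>

lemma orth_proj:
  assumes S: "linear_subspace G S"
  shows "orth_proj G S \<xi> \<in> S"
    and "\<zeta> \<in> S \<Longrightarrow> ip G (\<lambda>v. \<xi> v - orth_proj G S \<xi> v) \<zeta> = 0"
proof -
  define Q where "Q \<eta> \<longleftrightarrow> \<eta> \<in> S \<and> (\<forall>\<zeta>\<in>S. ip G (\<lambda>v. \<xi> v - \<eta> v) \<zeta> = 0)" for \<eta>
  obtain E where E: "finite E" "E \<subseteq> S" "orthonormal G E"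
    and span: "\<And>\<zeta>. \<zeta> \<in> S \<Longrightarrow> \<zeta> = fourier_sum G E \<zeta>"
    using ex_orthonormal_basis[OF S] by metis
  define \<eta> where "\<eta> = fourier_sum G E \<xi>"
  have "\<eta> \<in> S"
    unfolding \<eta>_def fourier_sum_def using E S
    by (intro linear_subspace_sum[OF S]) (auto simp: linear_subspace_def)
  moreover have "ip G (\<lambda>v. \<xi> v - \<eta> v) \<zeta> = 0" if "\<zeta> \<in> S" for \<zeta>
  proof -
    have "ip G \<zeta> (\<lambda>v. \<xi> v - \<eta> v) = (\<Sum>e\<in>E. ip G \<zeta> e * ip G e (\<lambda>v. \<xi> v - \<eta> v))"
      by (subst span[OF that]) (rule ip_fourier_sum_left)
    also have "\<dots> = 0"
      using ip_fourier_sum[OF E(1,3), of _ \<xi>]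
      by (intro sum.neutral) (simp add: ip_eq_0_commute[of G _ "\<lambda>v. \<xi> v - fourier_sum G E \<xi> v"] \<eta>_def)
    finally show ?thesis by (subst ip_eq_0_commute)
  qed
  ultimately have "Q \<eta>" by (simp add: Q_def)
  moreover have "\<eta>' = \<eta>" if "Q \<eta>'" for \<eta>'
  proof -
    let ?d = "\<lambda>v. \<eta>' v - \<eta> v"
    have d: "?d \<in> S" using that \<open>Q \<eta>\<close> by (intro linear_subspace_diff[OF S]) (auto simp: Q_def)
    have "ip G ?d ?d = 0"
      using that \<open>Q \<eta>\<close> d by (auto simp: Q_def ip_diff_left)
    then have "?d = (\<lambda>v. 0)"
      using d S ip_self_eq_0_iff[of ?d] by (auto simp: linear_subspace_def)
    then show ?thesis by (simp add: fun_eq_iff)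
  qed
  ultimately have "Q (orth_proj G S \<xi>)"
    unfolding orth_proj_def Q_def[symmetric] by (rule theI)
  then show "orth_proj G S \<xi> \<in> S" "\<zeta> \<in> S \<Longrightarrow> ip G (\<lambda>v. \<xi> v - orth_proj G S \<xi> v) \<zeta> = 0"
    by (auto simp: Q_def)
qed

text \<open>Taken for an eigenspace, this makes the spectral weight of the eigenvalue a squared
  norm, hence real and nonnegative.\<close>

lemma ip_orth_proj_self:
  assumes "linear_subspace G S"
  shows "ip G (orth_proj G S \<xi>) \<xi> = ip G (orth_proj G S \<xi>) (orth_proj G S \<xi>)"
proof -
  have "ip G (\<lambda>v. \<xi> v - orth_proj G S \<xi> v) (orth_proj G S \<xi>) = 0"
    using orth_proj[OF assms] by blast
  then have "ip G \<xi> (orth_proj G S \<xi>) = ip G (orth_proj G S \<xi>) (orth_proj G S \<xi>)"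
    by (simp add: ip_diff_left)
  then show ?thesis
    using ip_commute[of G "orth_proj G S \<xi>" \<xi>] ip_commute[of G "orth_proj G S \<xi>" "orth_proj G S \<xi>"]
    by simp
qed

section \<open>Self-adjointness of the adjacency operator and finiteness of its spectrum\<close>

lemma ip_adj_op: "ip G (adj_op G \<xi>) \<eta> = ip G \<xi> (adj_op G \<eta>)"
proof -
  have "ip G (adj_op G \<xi>) \<eta> =
      (\<Sum>v\<in>verts G. \<Sum>w\<in>verts G. if {v, w} \<in> edges G then \<xi> w * cnj (\<eta> v) else 0)"
    unfolding ip_def using fin
    by (intro sum.cong) (auto simp: adj_op_def sum_distrib_right sum.inter_filter intro!: sum.cong)
  \<comment> \<open>Edges are unordered pairs, so exchanging the sums moves the operator to the
    other argument.\<close>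
  also have "\<dots> = (\<Sum>w\<in>verts G. \<Sum>v\<in>verts G. if {w, v} \<in> edges G then \<xi> w * cnj (\<eta> v) else 0)"
    by (subst sum.swap) (simp add: insert_commute)
  also have "\<dots> = ip G \<xi> (adj_op G \<eta>)"
    unfolding ip_def using fin
    by (intro sum.cong) (auto simp: adj_op_def sum_distrib_left sum.inter_filter intro!: sum.cong)
  finally show ?thesis .
qed

lemma linear_subspace_eigenspace: "linear_subspace G (eigenspace G \<theta>)"
  unfolding linear_subspace_def
proof (intro conjI ballI allI)
  show "eigenspace G \<theta> \<subseteq> ell2 G" by (auto simp: eigenspace_def)
  show "(\<lambda>v. 0) \<in> eigenspace G \<theta>" by (auto simp: eigenspace_def ell2_def adj_op_def)
next
  fix \<xi> \<eta> assume "\<xi> \<in> eigenspace G \<theta>" "\<eta> \<in> eigenspace G \<theta>"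
  moreover have "adj_op G (\<lambda>v. \<xi> v + \<eta> v) = (\<lambda>v. adj_op G \<xi> v + adj_op G \<eta> v)"
    by (auto simp: adj_op_def sum.distrib)
  ultimately show "(\<lambda>v. \<xi> v + \<eta> v) \<in> eigenspace G \<theta>"
    by (auto simp: eigenspace_def ell2_def ring_distribs)
next
  fix c \<xi> assume "\<xi> \<in> eigenspace G \<theta>"
  moreover have "adj_op G (\<lambda>v. c * \<xi> v) = (\<lambda>v. c * adj_op G \<xi> v)"
    by (auto simp: adj_op_def sum_distrib_left)
  ultimately show "(\<lambda>v. c * \<xi> v) \<in> eigenspace G \<theta>"
    by (auto simp: eigenspace_def ell2_def)
qed

lemma spectrum_real:
  assumes "\<theta> \<in> spectrum G" shows "cnj \<theta> = \<theta>"
proof -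
  obtain \<xi> where \<xi>: "\<xi> \<in> ell2 G" "adj_op G \<xi> = (\<lambda>v. \<theta> * \<xi> v)" "\<xi> \<noteq> (\<lambda>v. 0)"
    using assms by (auto simp: spectrum_def eigenspace_def)
  have "\<theta> * ip G \<xi> \<xi> = cnj \<theta> * ip G \<xi> \<xi>"
    using ip_adj_op[of \<xi> \<xi>] by (simp add: \<xi> ip_scale_left ip_scale_right)
  then show ?thesis using \<xi> ip_self_eq_0_iff by auto
qed

lemma eigenspaces_orthogonal:
  assumes "\<theta> \<in> spectrum G" "\<theta>' \<in> spectrum G" "\<theta> \<noteq> \<theta>'"
    and "\<xi> \<in> eigenspace G \<theta>" "\<eta> \<in> eigenspace G \<theta>'"
  shows "ip G \<xi> \<eta> = 0"
proof -
  have "\<theta> * ip G \<xi> \<eta> = cnj \<theta>' * ip G \<xi> \<eta>"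
    using ip_adj_op[of \<xi> \<eta>] assms by (simp add: eigenspace_def ip_scale_left ip_scale_right)
  then show ?thesis using assms spectrum_real by auto
qed

text \<open>Unit eigenvectors for distinct eigenvalues form an orthonormal set, so the number of
  vertices bounds the size of every finite set of eigenvalues.\<close>

lemma finite_spectrum: "finite (spectrum G)"
proof -
  have "\<exists>\<xi>. \<xi> \<in> eigenspace G \<theta> \<and> ip G \<xi> \<xi> = 1" if "\<theta> \<in> spectrum G" for \<theta>
  proof -
    obtain \<xi> where \<xi>: "\<xi> \<in> eigenspace G \<theta>" "\<xi> \<noteq> (\<lambda>v. 0)"
      using \<open>\<theta> \<in> spectrum G\<close> by (auto simp: spectrum_def)
    then have "ip G \<xi> \<xi> \<noteq> 0" by (subst ip_self_eq_0_iff) (auto simp: eigenspace_def)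
    then obtain c where "ip G (\<lambda>v. c * \<xi> v) (\<lambda>v. c * \<xi> v) = 1"
      by (rule scaled_unit)
    then show ?thesis
      using \<xi> linear_subspace_eigenspace[of \<theta>] by (auto simp: linear_subspace_def)
  qed
  then obtain e where e: "\<And>\<theta>. \<theta> \<in> spectrum G \<Longrightarrow> e \<theta> \<in> eigenspace G \<theta> \<and> ip G (e \<theta>) (e \<theta>) = 1"
    by metis
  have "inj_on e (spectrum G)"
    using e eigenspaces_orthogonal by (intro inj_onI) (metis zero_neq_one)
  have "card T \<le> card (verts G)" if "T \<subseteq> spectrum G" "finite T" for T
  proof -
    have "orthonormal G (e ` T)"
      using that e eigenspaces_orthogonal unfolding orthonormal_def by (auto simp: subset_iff) metis+
    then have "card (e ` T) \<le> card (verts G)"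
      using that by (intro card_orthonormal_le) auto
    then show ?thesis
      using card_image[OF inj_on_subset[OF \<open>inj_on e (spectrum G)\<close> that(1)]] by simp
  qed
  then show ?thesis
    using finite_if_finite_subsets_card_bdd by blast
qed

subsection \<open>Local spectral measures\<close>

text \<open>Integrating \<open>indicator A\<close> recovers the mass of \<open>A\<close>. Uniqueness
  gives the definite description \<open>local_spectral_measure\<close> its meaning.\<close>

lemma is_local_spectral_measure_unique:
  assumes "is_local_spectral_measure G \<xi> \<mu>" "is_local_spectral_measure G \<xi> \<nu>"
  shows "\<mu> = \<nu>"
proof (rule measure_eqI)
  show "sets \<mu> = sets \<nu>" using assms by (simp add: is_local_spectral_measure_def)
next
  fix A assume A: "A \<in> sets \<mu>"
  have int: "of_real (measure M A) = ip G (fun_calc G (indicator A) \<xi>) \<xi>"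
    if M: "is_local_spectral_measure G \<xi> M" for M
  proof -
    interpret finite_measure M using M by (simp add: is_local_spectral_measure_def)
    have "A \<in> sets M" using A M assms by (simp add: is_local_spectral_measure_def)
    then have "(LINT x|M. indicator A x *\<^sub>R (1::complex)) = measure M A *\<^sub>R 1"
      by (simp add: emeasure_eq_measure)
    moreover have "(\<lambda>x. indicator A x *\<^sub>R (1::complex)) = indicator A"
      by (auto simp: indicator_def)
    ultimately show ?thesis
      using M by (simp add: is_local_spectral_measure_def of_real_def)
  qed
  have "measure \<mu> A = measure \<nu> A"
    using int[OF assms(1)] int[OF assms(2)] by (metis of_real_eq_iff)
  moreover have "finite_measure \<mu>" "finite_measure \<nu>"
    using assms by (auto simp: is_local_spectral_measure_def)
  ultimately show "emeasure \<mu> A = emeasure \<nu> A"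
    by (simp add: finite_measure.emeasure_eq_measure)
qed

text \<open>Integration against these weights is the finite sum behind \<open>fun_calc\<close>. The
  inner products are nonnegative reals, so \<open>Re\<close> and \<open>ennreal\<close> lose
  nothing.\<close>

lemma local_spectral_measure_eq_point_measure:
  "local_spectral_measure G \<xi> =
     point_measure (spectrum G) (\<lambda>\<theta>. ennreal (Re (ip G (orth_proj G (eigenspace G \<theta>) \<xi>) \<xi>)))"
    (is "_ = point_measure _ (\<lambda>\<theta>. ennreal (?w \<theta>))")
proof -
  let ?\<mu> = "point_measure (spectrum G) (\<lambda>\<theta>. ennreal (?w \<theta>))"
  have w: "?w \<theta> \<ge> 0 \<and> ip G (orth_proj G (eigenspace G \<theta>) \<xi>) \<xi> = of_real (?w \<theta>)" for \<theta>
    unfolding ip_orth_proj_self[OF linear_subspace_eigenspace] ip_self by (simp add: sum_nonneg)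
  have "is_local_spectral_measure G \<xi> ?\<mu>"
    unfolding is_local_spectral_measure_def
  proof (intro conjI allI)
    show "sets ?\<mu> = Pow (spectrum G)" by (simp add: sets_point_measure)
    show "finite_measure ?\<mu>"
      by (intro finite_measureI)
        (simp add: space_point_measure emeasure_point_measure_finite finite_spectrum)
  next
    fix f :: "complex \<Rightarrow> complex"
    have "(LINT x|?\<mu>. f x) = (\<Sum>\<theta>\<in>spectrum G. ?w \<theta> *\<^sub>R f \<theta>)"
      unfolding point_measure_def
      using finite_spectrum w by (subst integral_density) (auto simp: lebesgue_integral_count_space_finite)
    also have "\<dots> = (\<Sum>\<theta>\<in>spectrum G. f \<theta> * ip G (orth_proj G (eigenspace G \<theta>) \<xi>) \<xi>)"
      by (intro sum.cong refl) (subst (2) w[THEN conjunct2], simp add: scaleR_conv_of_real)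
    also have "\<dots> = ip G (fun_calc G f \<xi>) \<xi>"
      by (simp add: fun_calc_def ip_sum_left ip_scale_left)
    finally show "(LINT x|?\<mu>. f x) = ip G (fun_calc G f \<xi>) \<xi>" .
  qed
  then show ?thesis
    unfolding local_spectral_measure_def
    using is_local_spectral_measure_unique by (intro the_equality) auto
qed

text \<open>The mass at \<open>\<theta>\<close> is the squared norm of the projection of
  \<open>\<xi>\<close> to the eigenspace.\<close>

lemma null_singleton_local_spectral_measure_iff:
  assumes "\<theta> \<in> spectrum G"
  shows "{\<theta>} \<in> null_sets (local_spectral_measure G \<xi>) \<longleftrightarrow> (\<forall>\<zeta>\<in>eigenspace G \<theta>. ip G \<xi> \<zeta> = 0)"
proof -
  let ?P = "orth_proj G (eigenspace G \<theta>) \<xi>"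
  note sub = linear_subspace_eigenspace[of \<theta>]
  have P: "?P \<in> eigenspace G \<theta>" by (rule orth_proj(1)[OF sub])
  have orth: "ip G \<xi> \<zeta> = ip G ?P \<zeta>" if "\<zeta> \<in> eigenspace G \<theta>" for \<zeta>
    using orth_proj(2)[OF sub that, of \<xi>] by (simp add: ip_diff_left)
  have eq: "ip G ?P \<xi> = ip G ?P ?P" by (rule ip_orth_proj_self[OF sub])
  have "{\<theta>} \<in> null_sets (local_spectral_measure G \<xi>) \<longleftrightarrow> ennreal (Re (ip G ?P \<xi>)) = 0"
    using assms finite_spectrum
    by (simp add: local_spectral_measure_eq_point_measure null_sets_def sets_point_measure
        emeasure_point_measure_finite)
  also have "\<dots> \<longleftrightarrow> ip G ?P ?P = 0"
    unfolding eq ip_self of_real_eq_0_iff Re_complex_of_real ennreal_eq_0_iff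
    using sum_nonneg[of "verts G" "\<lambda>v. (cmod (?P v))\<^sup>2"] by auto
  also have "\<dots> \<longleftrightarrow> ?P = (\<lambda>v. 0)"
    using P by (intro ip_self_eq_0_iff) (simp add: eigenspace_def)
  also have "\<dots> \<longleftrightarrow> (\<forall>\<zeta>\<in>eigenspace G \<theta>. ip G \<xi> \<zeta> = 0)"
  proof
    assume "\<forall>\<zeta>\<in>eigenspace G \<theta>. ip G \<xi> \<zeta> = 0"
    then have "ip G ?P ?P = 0" using orth[OF P] P by simp
    then show "?P = (\<lambda>v. 0)"
      using P ip_self_eq_0_iff[of ?P] by (simp add: eigenspace_def)
  qed (simp add: orth ip_zero_left)
  finally show ?thesis .
qed

lemma dominant_imp_eigenvector_nonzero_at:
  assumes dom: "dominant G v" and \<theta>: "\<theta> \<in> spectrum G"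
  shows "\<exists>\<zeta>\<in>eigenspace G \<theta>. \<zeta> v \<noteq> 0"
proof (rule ccontr)
  assume "\<not> ?thesis"
  moreover have v: "v \<in> verts G" using dom by (simp add: dominant_def)
  ultimately have "{\<theta>} \<in> null_sets (local_spectral_measure G (delta v))"
    by (simp add: null_singleton_local_spectral_measure_iff[OF \<theta>] ip_delta_left)
  moreover obtain \<xi> where \<xi>: "\<xi> \<in> eigenspace G \<theta>" "\<xi> \<noteq> (\<lambda>v. 0)"
    using \<theta> by (auto simp: spectrum_def)
  then have "absolutely_continuous (local_spectral_measure G (delta v)) (local_spectral_measure G \<xi>)"
    using dom by (simp add: dominant_def eigenspace_def)
  ultimately have "{\<theta>} \<in> null_sets (local_spectral_measure G \<xi>)"
    by (auto simp: absolutely_continuous_def)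
  then have "ip G \<xi> \<xi> = 0"
    using \<xi> by (simp add: null_singleton_local_spectral_measure_iff[OF \<theta>])
  then show False using \<xi> ip_self_eq_0_iff[of \<xi>] by (simp add: eigenspace_def)
qed

end

subsection \<open>Sine sequences\<close>

text \<open>At integers \<open>x\<close> this is the eigenvalue equation inside a path, for the
  eigenvalue \<open>2 * cos \<alpha>\<close>.\<close>

lemma sin_multiple_recurrence:
  "sin ((x - 1) * \<alpha>) + sin ((x + 1) * \<alpha>) = 2 * cos \<alpha> * sin (x * (\<alpha>::real))"
  by (simp add: ring_distribs sin_add sin_diff)

text \<open>The values at 0 and 1 determine a solution of a second-order recurrence. Multiplying by
  \<open>sin \<alpha>\<close> avoids a division. The recurrence stops below \<open>m\<close>, the
  future place of the center, but still determines \<open>f m\<close>.\<close>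

lemma sin_recurrence:
  fixes f :: "nat \<Rightarrow> complex" and \<alpha> :: real
  assumes "f 0 = 0" and "\<And>i. \<lbrakk>1 \<le> i; i < m\<rbrakk> \<Longrightarrow> f (i - 1) + f (i + 1) = of_real (2 * cos \<alpha>) * f i"
    and "i \<le> m"
  shows "f i * of_real (sin \<alpha>) = f 1 * of_real (sin (i * \<alpha>))"
  using assms(3)
proof (induction i rule: less_induct)
  case (less i)
  consider "i = 0" | "i = 1" | j where "i = Suc (Suc j)"
    by (metis One_nat_def old.nat.exhaust)
  then show ?case
  proof cases
    case 3
    have "f i = of_real (2 * cos \<alpha>) * f (j + 1) - f j"
      using assms(2)[of "j + 1"] less.prems 3 by (simp add: algebra_simps)
    then have "f i * of_real (sin \<alpha>) =
        of_real (2 * cos \<alpha>) * (f (j + 1) * of_real (sin \<alpha>)) - f j * of_real (sin \<alpha>)"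
      by (simp only: left_diff_distrib mult.assoc)
    also have "\<dots> = f 1 * of_real (2 * cos \<alpha> * sin ((j + 1) * \<alpha>) - sin (j * \<alpha>))"
      using less.IH[of j] less.IH[of "j + 1"] less.prems 3 by (simp add: algebra_simps)
    also have "2 * cos \<alpha> * sin ((j + 1) * \<alpha>) - sin (j * \<alpha>) = sin (i * \<alpha>)"
      using 3 sin_multiple_recurrence[of "real (j + 1)" \<alpha>] by (simp add: algebra_simps)
    finally show ?thesis .
  qed (simp_all add: assms)
qed

lemma sin_pi_div_pos: "p \<ge> 2 \<Longrightarrow> sin (pi / real p) > 0"
  by (intro sin_gt_zero) (auto simp: field_simps)

text \<open>The zeros of \<open>sin\<close> are the integer multiples of \<open>pi\<close>, so the
  quotient of \<open>q\<close> by \<open>p\<close> has to be an integer.\<close>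

lemma sin_multiple_pi_div_eq_0_iff:
  assumes "p > 0"
  shows "sin (real q * (pi / real p)) = 0 \<longleftrightarrow> p dvd q"
proof -
  have "sin (real q * (pi / real p)) = 0 \<longleftrightarrow> (\<exists>i::int. real q * (pi / real p) = of_int i * pi)"
    by (rule sin_zero_iff_int2)
  also have "\<dots> \<longleftrightarrow> (\<exists>i::int. int q = int p * i)"
  proof (intro ex_cong1)
    fix i :: int
    have "real q * (pi / real p) = of_int i * pi \<longleftrightarrow> real_of_int (int q) = real_of_int (int p * i)"
      using assms by (simp add: field_simps)
    then show "real q * (pi / real p) = of_int i * pi \<longleftrightarrow> int q = int p * i"
      by (simp only: of_int_eq_iff)
  qed
  also have "\<dots> \<longleftrightarrow> p dvd q"
    unfolding int_dvd_int_iff[symmetric] dvd_def ..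
  finally show ?thesis .
qed

text \<open>For reading a right arm from its leaf: \<open>j\<close> stands for the index
  \<open>n + 1 - j\<close>, so 0 goes to \<open>n + 1\<close>, just beyond the leaf, and
  \<open>n - k + 1\<close> goes to the center \<open>k\<close>. The bounds on \<open>j\<close> keep
  the truncated subtractions exact.\<close>

lemma recurrence_reverse:
  fixes f :: "nat \<Rightarrow> complex"
  assumes "\<And>i. \<lbrakk>1 \<le> i; i \<le> n; i \<noteq> k\<rbrakk> \<Longrightarrow> f (i - 1) + f (i + 1) = \<theta> * f i"
    and "1 \<le> j" "j < n - k + 1" "k \<le> n"
  shows "f (n + 1 - (j - 1)) + f (n + 1 - (j + 1)) = \<theta> * f (n + 1 - j)"
proof -
  have "n + 1 - (j - 1) = n + 1 - j + 1" "n + 1 - (j + 1) = n + 1 - j - 1"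
    using assms(2-4) by auto
  moreover have "f (n + 1 - j - 1) + f (n + 1 - j + 1) = \<theta> * f (n + 1 - j)"
    using assms(2-4) by (intro assms(1)) auto
  ultimately show ?thesis by (simp only: add.commute)
qed

text \<open>A zero at \<open>m\<close>, where the sine is nonzero, kills the factor
  \<open>f 1\<close> and with it the whole arm.\<close>

lemma recurrence_eq_0:
  fixes f :: "nat \<Rightarrow> complex" and \<alpha> :: real
  assumes "f 0 = 0" "\<And>i. \<lbrakk>1 \<le> i; i < m\<rbrakk> \<Longrightarrow> f (i - 1) + f (i + 1) = of_real (2 * cos \<alpha>) * f i"
    and "f m = 0" "sin \<alpha> \<noteq> 0" "sin (m * \<alpha>) \<noteq> 0" "i \<le> m"
  shows "f i = 0"
proof -
  note rec = sin_recurrence[of f m \<alpha>, OF assms(1,2)]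
  have "f 1 = 0" using rec[of m] assms by simp
  then show ?thesis using rec[of i] assms by simp
qed

text \<open>Here the sine vanishes at \<open>m\<close>, so the arm forces the value 0 at the
  center.\<close>

lemma recurrence_end_eq_0:
  fixes f :: "nat \<Rightarrow> complex" and \<alpha> :: real
  assumes "f 0 = 0" "\<And>i. \<lbrakk>1 \<le> i; i < m\<rbrakk> \<Longrightarrow> f (i - 1) + f (i + 1) = of_real (2 * cos \<alpha>) * f i"
    and "sin \<alpha> \<noteq> 0" "sin (m * \<alpha>) = 0"
  shows "f m = 0"
  using sin_recurrence[of f m \<alpha> m, OF assms(1,2)] assms by simp

subsection \<open>The tree obtained from two paths\<close>

text \<open>\<open>Inr k\<close> is not a vertex of the tree, so the second path is enumerated by \<open>glue k\<close>.\<close>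

definition glue :: "nat \<Rightarrow> nat \<Rightarrow> nat + nat" where
  "glue k i = (if i = k then Inl k else Inr i)"

lemma verts_X_tree: "verts (X_tree n k) = Inl ` {1..n} \<union> glue k ` {1..n}"
proof -
  let ?h = "\<lambda>x. if x = Inr k then Inl k else x"
  have "?h ` (Inl ` {1..n}) = Inl ` {1..n}" "?h ` (Inr ` {1..n}) = glue k ` {1..n}"
    unfolding image_image by (auto simp: glue_def intro!: image_cong)
  then show ?thesis
    unfolding X_tree_def identify_def map_graph_def disjoint_union_def path_graph_def
      verts_def edges_def fst_conv image_Un by (simp only:)
qed

lemma edges_X_tree:
  "edges (X_tree n k) =
     (\<lambda>i. {Inl i, Inl (i + 1)}) ` {1..<n} \<union> (\<lambda>i. {glue k i, glue k (i + 1)}) ` {1..<n}"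
proof -
  let ?h = "\<lambda>x. if x = Inr k then Inl k else x"
  have path: "{{i, i + 1} |i. 1 \<le> i \<and> i < n} = (\<lambda>i. {i, i + 1}) ` {1..<n}"
    by auto
  have "(\<lambda>e. ?h ` e) ` ((\<lambda>e. Inl ` e) ` (\<lambda>i. {i, i + 1}) ` {1..<n}) = (\<lambda>i. {Inl i, Inl (i + 1)}) ` {1..<n}"
    "(\<lambda>e. ?h ` e) ` ((\<lambda>e. Inr ` e) ` (\<lambda>i. {i, i + 1}) ` {1..<n}) = (\<lambda>i. {glue k i, glue k (i + 1)}) ` {1..<n}"
    unfolding image_image by (auto simp: glue_def intro!: image_cong)
  then show ?thesis
    by (simp add: X_tree_def identify_def map_graph_def disjoint_union_def path_graph_def
        verts_def edges_def image_Un path del: One_nat_def)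
qed

lemma finite_verts_X_tree: "finite (verts (X_tree n k))"
  by (simp add: verts_X_tree)

text \<open>\<open>N\<close> may contain points outside the graph, where \<open>\<xi>\<close>
  vanishes. The ends of the paths thus obey the same formula as inner vertices, with neighbors of
  index 0 or \<open>n + 1\<close> contributing 0.\<close>

lemma adj_op_eq_sum:
  assumes "\<xi> \<in> ell2 G" "v \<in> verts G" "finite N"
    and "\<And>w. w \<in> verts G \<Longrightarrow> {v, w} \<in> edges G \<longleftrightarrow> w \<in> N"
  shows "adj_op G \<xi> v = (\<Sum>w\<in>N. \<xi> w)"
  unfolding adj_op_def using assms
  by (auto simp: ell2_def intro!: sum.mono_neutral_left)

lemma glue_eq_iff [simp]:
  "glue k i = glue k j \<longleftrightarrow> i = j" "glue k i = Inl j \<longleftrightarrow> i = k \<and> j = k"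
  "Inl j = glue k i \<longleftrightarrow> i = k \<and> j = k"
  by (auto simp: glue_def)

lemma adj_op_X_tree_Inl:
  assumes "\<xi> \<in> ell2 (X_tree n k)" "1 \<le> i" "i \<le> n" "i \<noteq> k"
  shows "adj_op (X_tree n k) \<xi> (Inl i) = \<xi> (Inl (i - 1)) + \<xi> (Inl (i + 1))"
proof -
  have "adj_op (X_tree n k) \<xi> (Inl i) = (\<Sum>w\<in>{Inl (i - 1), Inl (i + 1)}. \<xi> w)"
    using assms
    by (intro adj_op_eq_sum) (auto simp: verts_X_tree edges_X_tree doubleton_eq_iff image_iff Bex_def; presburger)+
  then show ?thesis by simp
qed

lemma adj_op_X_tree_glue:
  assumes "\<xi> \<in> ell2 (X_tree n k)" "1 \<le> i" "i \<le> n" "i \<noteq> k"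
  shows "adj_op (X_tree n k) \<xi> (glue k i) = \<xi> (glue k (i - 1)) + \<xi> (glue k (i + 1))"
proof -
  have "adj_op (X_tree n k) \<xi> (glue k i) = (\<Sum>w\<in>{glue k (i - 1), glue k (i + 1)}. \<xi> w)"
    using assms
    by (intro adj_op_eq_sum) (auto simp: verts_X_tree edges_X_tree doubleton_eq_iff image_iff Bex_def; presburger)+
  then show ?thesis by simp
qed

lemma adj_op_X_tree_center:
  assumes "\<xi> \<in> ell2 (X_tree n k)" "1 < k" "k < n"
  shows "adj_op (X_tree n k) \<xi> (Inl k) =
    \<xi> (Inl (k - 1)) + \<xi> (Inl (k + 1)) + \<xi> (glue k (k - 1)) + \<xi> (glue k (k + 1))"
proof -
  have "adj_op (X_tree n k) \<xi> (Inl k) =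
      (\<Sum>w\<in>{Inl (k - 1), Inl (k + 1), glue k (k - 1), glue k (k + 1)}. \<xi> w)"
    using assms
    by (intro adj_op_eq_sum) (auto simp: verts_X_tree edges_X_tree doubleton_eq_iff image_iff Bex_def; presburger)+
  \<comment> \<open>This makes the four listed neighbors pairwise distinct, so that the sum has four
    terms.\<close>
  moreover have "k - 1 \<noteq> k + 1" "k - 1 \<noteq> k" using assms by auto
  ultimately show ?thesis by (simp add: add.assoc)
qed

section \<open>Eigenvectors along the two paths\<close>

lemma eigenvector_X_tree_recurrence:
  assumes "\<xi> \<in> eigenspace (X_tree n k) \<theta>" "f = (\<lambda>i. \<xi> (Inl i)) \<or> f = (\<lambda>i. \<xi> (glue k i))"
    and "1 \<le> k" "k \<le> n"
  shows "f 0 = 0" "f (n + 1) = 0"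
    and "\<And>i. \<lbrakk>1 \<le> i; i \<le> n; i \<noteq> k\<rbrakk> \<Longrightarrow> f (i - 1) + f (i + 1) = \<theta> * f i"
proof -
  have \<xi>: "\<xi> \<in> ell2 (X_tree n k)" "adj_op (X_tree n k) \<xi> = (\<lambda>v. \<theta> * \<xi> v)"
    using assms by (auto simp: eigenspace_def)
  show "f 0 = 0" "f (n + 1) = 0"
    using assms \<xi>(1) by (auto simp: ell2_def verts_X_tree image_iff)
  \<comment> \<open>The index \<open>k\<close> is excluded because the center has further neighbors
    on the other path.\<close>
  show "f (i - 1) + f (i + 1) = \<theta> * f i" if "1 \<le> i" "i \<le> n" "i \<noteq> k" for i
    using adj_op_X_tree_Inl[OF \<xi>(1) that] adj_op_X_tree_glue[OF \<xi>(1) that] assms(2) \<xi>(2) by auto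
qed

text \<open>Take \<open>u\<close> on one path and \<open>- u\<close> on the other. They agree at the
  center since \<open>u k = 0\<close>, and the contributions of the neighbors of the center cancel
  in pairs.\<close>

lemma antisymmetric_eigenvalue_X_tree:
  fixes u :: "nat \<Rightarrow> complex"
  assumes k: "1 < k" "k < n" and u: "u k = 0" "\<And>i. i < 1 \<or> n < i \<Longrightarrow> u i = 0" "u \<noteq> (\<lambda>i. 0)"
    and rec: "\<And>i. \<lbrakk>1 \<le> i; i \<le> n; i \<noteq> k\<rbrakk> \<Longrightarrow> u (i - 1) + u (i + 1) = \<theta> * u i"
  shows "\<theta> \<in> spectrum (X_tree n k)"
proof -
  define \<xi> where "\<xi> = case_sum u (\<lambda>i. - u i)"
  have vals: "\<xi> (Inl i) = u i" "\<xi> (glue k i) = - u i" for i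
    using u by (auto simp: \<xi>_def glue_def)
  have \<xi>: "\<xi> \<in> ell2 (X_tree n k)"
  proof -
    have "\<xi> x = 0" if x: "x \<notin> verts (X_tree n k)" for x
    proof (cases x)
      case (Inl i)
      then have "i < 1 \<or> n < i" using x by (auto simp: verts_X_tree)
      then show ?thesis using Inl u(2)[of i] by (simp add: \<xi>_def)
    next
      case (Inr i)
      \<comment> \<open>\<open>Inr k\<close> is no vertex; the value there is \<open>- u k\<close>,
        which is 0 as \<open>ell2\<close> demands.\<close>
      then have "i = k \<or> i < 1 \<or> n < i"
        using x by (auto simp: verts_X_tree image_iff glue_def)
      then show ?thesis using Inr u(1) u(2)[of i] by (auto simp: \<xi>_def)
    qed
    then show ?thesis by (simp add: ell2_def)
  qed
  have "adj_op (X_tree n k) \<xi> x = \<theta> * \<xi> x" for x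
  proof (cases "x \<in> verts (X_tree n k)")
    case False
    then show ?thesis using \<xi> by (simp add: adj_op_def ell2_def)
  next
    case True
    then consider "x = Inl k" | i where "x = Inl i" "1 \<le> i" "i \<le> n" "i \<noteq> k"
      | i where "x = glue k i" "1 \<le> i" "i \<le> n" "i \<noteq> k"
      by (auto simp: verts_X_tree glue_def split: if_splits) blast
    then show ?thesis
    proof cases
      case 1
      then show ?thesis using adj_op_X_tree_center[OF \<xi> k] u(1) by (simp add: vals)
    next
      case 2
      then show ?thesis using adj_op_X_tree_Inl[OF \<xi> 2(2-4)] rec[OF 2(2-4)] by (simp add: vals)
    next
      case 3
      have "- u (i - 1) - u (i + 1) = - (\<theta> * u i)"
        using rec[OF 3(2-4)] by (metis minus_add uminus_add_conv_diff)
      then show ?thesis using adj_op_X_tree_glue[OF \<xi> 3(2-4)] 3 by (simp add: vals)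
    qed
  qed
  moreover have "\<xi> \<noteq> (\<lambda>v. 0)"
    using u(3) vals(1) by metis
  ultimately show ?thesis using \<xi> by (auto simp: spectrum_def eigenspace_def)
qed

section \<open>The two eigenvalues and the exclusion of every vertex\<close>

theorem proposition5p6:
  fixes n k :: nat
  assumes "n \<ge> 4"
    and "2 \<le> k"
    and "real k \<le> (real n + 1) / 2"
    and "coprime k (n - k + 1)"
  shows "\<not> (\<exists>v. dominant (X_tree n k) v)"
proof
  define q where "q = n - k + 1"
  have "2 * k \<le> n + 1" using assms(3) by (simp add: field_simps flip: of_nat_le_iff[where 'a = real])
  then have k: "1 < k" "k < n" "1 \<le> k" "k \<le> n" and q: "q \<ge> 2" "n + 1 = k + q"
    using assms unfolding q_def by auto
  have cop: "coprime k q" using assms(4) by (simp add: q_def)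
  \<comment> \<open>Both numbers are at least 2, so divisibility would contradict
    coprimality.\<close>
  have ndvd: "\<not> k dvd q" "\<not> q dvd k"
    using cop assms(2) q(1) coprime_absorb_left coprime_absorb_right by force+
  define \<alpha> \<beta> where "\<alpha> = pi / real k" and "\<beta> = pi / real q"
  have sin_pos: "sin \<alpha> > 0" "sin \<beta> > 0"
    using assms(2) q(1) by (simp_all add: \<alpha>_def \<beta>_def sin_pi_div_pos)
  have sin0: "sin (k * \<alpha>) = 0" "sin (q * \<beta>) = 0"
    using assms(2) q(1) by (simp_all add: \<alpha>_def \<beta>_def)
  have sin_ne: "sin (q * \<alpha>) \<noteq> 0" "sin (k * \<beta>) \<noteq> 0"
    unfolding \<alpha>_def \<beta>_def using ndvd assms(2) q(1) by (subst sin_multiple_pi_div_eq_0_iff; simp)+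

  have spec_\<alpha>: "of_real (2 * cos \<alpha>) \<in> spectrum (X_tree n k)"
  proof -
    let ?u = "\<lambda>i. if i \<le> k then complex_of_real (sin (i * \<alpha>)) else 0"
    show ?thesis
    proof (rule antisymmetric_eigenvalue_X_tree[OF k(1,2), of ?u])
      show "?u k = 0" using sin0 by simp
      show "?u i = 0" if "i < 1 \<or> n < i" for i using that k by auto
      have "?u 1 \<noteq> 0" using sin_pos k by simp
      then show "?u \<noteq> (\<lambda>i. 0)" by metis
      show "?u (i - 1) + ?u (i + 1) = of_real (2 * cos \<alpha>) * ?u i" if "1 \<le> i" "i \<le> n" "i \<noteq> k" for i
      proof (cases "i < k")
        case True
        then show ?thesis
          using sin_multiple_recurrence[of "real i" \<alpha>] that
          by (auto simp: add.commute simp flip: of_real_add of_real_mult)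
      next
        case False
        \<comment> \<open>If \<open>i - 1\<close> is the center, the sine branch of
          \<open>?u\<close> still applies and gives \<open>sin (k * \<alpha>) = 0\<close>.\<close>
        then have "i - 1 = k \<or> i - 1 > k" using that by auto
        then show ?thesis using False that sin0 by auto
      qed
    qed
  qed
  have spec_\<beta>: "of_real (2 * cos \<beta>) \<in> spectrum (X_tree n k)"
  proof -
    \<comment> \<open>The index \<open>n + 1 - i\<close> counts from the leaf and equals
      \<open>q\<close> at the center.\<close>
    let ?u = "\<lambda>i. if k \<le> i \<and> i \<le> n then complex_of_real (sin (real (n + 1 - i) * \<beta>)) else 0"
    show ?thesis
    proof (rule antisymmetric_eigenvalue_X_tree[OF k(1,2), of ?u])
      show "?u k = 0" using sin0 q by simp
      show "?u i = 0" if "i < 1 \<or> n < i" for i using that k by auto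
      have "?u n \<noteq> 0" using sin_pos k by simp
      then show "?u \<noteq> (\<lambda>i. 0)" by metis
      show "?u (i - 1) + ?u (i + 1) = of_real (2 * cos \<beta>) * ?u i" if "1 \<le> i" "i \<le> n" "i \<noteq> k" for i
      proof (cases "i > k")
        case True
        \<comment> \<open>At \<open>i = n\<close> the default value 0 agrees with the sine at index
          0.\<close>
        have "?u (i + 1) = of_real (sin (real (n + 1 - (i + 1)) * \<beta>))"
          using True that by (cases "i = n") auto
        then show ?thesis
          using sin_multiple_recurrence[of "real (n + 1 - i)" \<beta>] that True
          by (auto simp: algebra_simps simp flip: of_real_add of_real_mult)
      next
        case False
        then have "i + 1 = k \<or> i + 1 < k" using that by auto
        then show ?thesis using False that sin0 q by auto
      qed
    qed
  qed

  assume "\<exists>v. dominant (X_tree n k) v"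
  then obtain v where v: "dominant (X_tree n k) v" by blast
  then have "v \<in> verts (X_tree n k)"
    by (simp add: dominant_def)
  \<comment> \<open>\<open>f\<close> enumerates a path through \<open>v\<close>, which treats both
    paths at once.\<close>
  then have "\<exists>f i. (f = Inl \<or> f = glue k) \<and> v = f i \<and> i \<in> {1..n}"
    unfolding verts_X_tree by blast
  then obtain f i where i: "1 \<le> i" "i \<le> n" and f: "f = Inl \<or> f = glue k" "v = f i"
    by auto
  show False
  proof (cases "k \<le> i")
    \<comment> \<open>For \<open>v\<close> at the center or on a right arm: the left arm of the path
      \<open>f\<close> forces the value 0 at the center for \<open>\<alpha>\<close>, and then the
      right arm vanishes.\<close>
    case True
    obtain \<zeta> where \<zeta>: "\<zeta> \<in> eigenspace (X_tree n k) (of_real (2 * cos \<alpha>))" "\<zeta> v \<noteq> 0"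
      using dominant_imp_eigenvector_nonzero_at[OF finite_verts_X_tree v spec_\<alpha>] by blast
    define g where "g j = \<zeta> (f j)" for j
    have "g = (\<lambda>i. \<zeta> (Inl i)) \<or> g = (\<lambda>i. \<zeta> (glue k i))"
      using f by (auto simp: g_def)
    note g = eigenvector_X_tree_recurrence[OF \<zeta>(1) this k(3,4)]
    have "g k = 0"
      by (rule recurrence_end_eq_0[of g k \<alpha>]) (use g k sin_pos sin0 in auto)
    \<comment> \<open>The index \<open>i\<close> is written in the form that the reversed sequence
      produces.\<close>
    have "g (n + 1 - (n + 1 - i)) = 0"
    proof (rule recurrence_eq_0[of "\<lambda>j. g (n + 1 - j)" q \<alpha>])
      show "g (n + 1 - (j - 1)) + g (n + 1 - (j + 1)) = of_real (2 * cos \<alpha>) * g (n + 1 - j)"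
        if "1 \<le> j" "j < q" for j
        using recurrence_reverse[OF g(3) that(1) _ k(4)] that(2) by (simp add: q_def)
    qed (use g q i True \<open>g k = 0\<close> sin_pos sin_ne in auto)
    then show False using i \<zeta> f by (simp add: g_def)
  next
    \<comment> \<open>For \<open>v\<close> on a left arm the arms exchange roles: with
      \<open>\<beta>\<close>, the right arm forces the value 0 at the center, whose index is
      \<open>n + 1 - q\<close>.\<close>
    case False
    obtain \<zeta> where \<zeta>: "\<zeta> \<in> eigenspace (X_tree n k) (of_real (2 * cos \<beta>))" "\<zeta> v \<noteq> 0"
      using dominant_imp_eigenvector_nonzero_at[OF finite_verts_X_tree v spec_\<beta>] by blast
    define g where "g j = \<zeta> (f j)" for j
    have "g = (\<lambda>i. \<zeta> (Inl i)) \<or> g = (\<lambda>i. \<zeta> (glue k i))"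
      using f by (auto simp: g_def)
    note g = eigenvector_X_tree_recurrence[OF \<zeta>(1) this k(3,4)]
    have "g (n + 1 - q) = 0"
    proof (rule recurrence_end_eq_0[of "\<lambda>j. g (n + 1 - j)" q \<beta>])
      show "g (n + 1 - (j - 1)) + g (n + 1 - (j + 1)) = of_real (2 * cos \<beta>) * g (n + 1 - j)"
        if "1 \<le> j" "j < q" for j
        using recurrence_reverse[OF g(3) that(1) _ k(4)] that(2) by (simp add: q_def)
    qed (use g sin_pos sin0 in auto)
    then have "g k = 0" using q by simp
    have "g i = 0"
      by (rule recurrence_eq_0[of g k \<beta>]) (use g k i False \<open>g k = 0\<close> sin_pos sin_ne in auto)
    then show False using \<zeta> f by (simp add: g_def)
  qed
qed

end
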